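(* As $t\to\infty$ through the integers, \[ c_t^{\mathrm S}=\frac12-\frac1{\sqrt t}-\frac7{8t}+O(t^{-3/2}). \] Moreover, $c_t^{\mathrm S}>c_t^{\mathrm F}$ for every integer $t\geq 14$.
   Context: For an integer $t\geq 3$ put $d_t=\binom t2$, \[ A_t^{\mathrm S}=\max_{1\leq q\leq t-1}\frac{q}{q+1}\left(t-\frac{q+1}{2}\right)^2\quad(\text{maximum over integers } q),\qquad c_t^{\mathrm S}=\max\left\{0,1-\frac{d_t}{A_t^{\mathrm S}}\right\}. \] Let $x_0\in(\pi,3\pi/2)$ be the first positive root of $\tan x=x$, let $\gamma_0=-\dfrac{2\sin x_0}{x_0}$ (numerically $0.434467256422\ldots$), and put \[ c_t^{\mathrm F}=\frac{(t-1)\gamma_0-2}{2(t-2)}. \] *)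

theory Defs
  imports "HOL-Analysis.Analysis" "HOL-Library.Landau_Symbols"
begin

(* Only the values at t >= 3 are meaningful. *)

definition d :: "nat \<Rightarrow> nat" where
  "d t = t choose 2"

definition A_S :: "nat \<Rightarrow> real" where
  "A_S t = Max ((\<lambda>q. real q / (real q + 1) * (real t - (real q + 1) / 2)\<^sup>2) ` {1..t - 1})"

definition c_S :: "nat \<Rightarrow> real" where
  "c_S t = max 0 (1 - real (d t) / A_S t)"

(* The convention tan (pi / 2) = 0, coming from division by zero, creates no
   spurious positive root of tan x = x. *)
definition x0 :: real where
  "x0 = (THE x. x \<in> {pi<..<3 * pi / 2} \<and> tan x = x \<and> (\<forall>y\<in>{0<..<x}. tan y \<noteq> y))"

definition gamma0 :: real where
  "gamma0 = - (2 * sin x0 / x0)"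

definition c_F :: "nat \<Rightarrow> real" where
  "c_F t = ((real t - 1) * gamma0 - 2) / (2 * (real t - 2))"

end

theory Submission
  imports Defs "HOL-Real_Asymp.Real_Asymp"
begin

text \<open>
  Put \<open>s = q + 1\<close> and \<open>r = sqrt t\<close>. The objective of \<open>A_S\<close> equals
  \<open>r^4 - 2 r^3 + r^2 + (s^2 - s) / 4 - r^2 (s - r)^2 / s\<close>; the last term forces the maximiser to lie
  within \<open>O(1)\<close> of \<open>r\<close>, and so \<open>A_S t = t^2 - 2 t^(3/2) + 5 t / 4 + O(sqrt t)\<close>. The expansion of
  \<open>c_S\<close> follows.

  For the inequality the single choice \<open>q = 3\<close> is enough: it gives \<open>A_S t \<ge> 3 (t - 2)^2 / 4\<close>, which
  beats \<open>c_F\<close> for all \<open>t \<ge> 14\<close> as soon as \<open>gamma0 < 4 / 9\<close>. Since \<open>tan x0 = x0\<close>, we have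
  \<open>gamma0 = -2 cos x0\<close>, and the estimate reduces to a crude lower bound for \<open>x0\<close>.
\<close>

section \<open>Two-sided bounds for the maximum \<open>A_S\<close>, with error of order
  \<open>sqrt t\<close>\<close>

lemma A_S_ge:
  assumes "1 \<le> q" "q \<le> t - 1"
  shows "real q / (real q + 1) * (real t - (real q + 1) / 2)\<^sup>2 \<le> A_S t"
  unfolding A_S_def using assms by (intro Max_ge) auto

lemma A_S_le:
  assumes "2 \<le> t"
    and "\<And>q. 1 \<le> q \<Longrightarrow> q \<le> t - 1 \<Longrightarrow>
      real q / (real q + 1) * (real t - (real q + 1) / 2)\<^sup>2 \<le> b"
  shows "A_S t \<le> b"
  unfolding A_S_def using assms by (intro Max.boundedI) auto

text \<open>Completes the square: \<open>r^4 / s + r^2 * s\<close> equals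
  \<open>2 * r^3 + r^2 * (s - r)^2 / s\<close>.\<close>

lemma objective_expand:
  fixes r s :: real
  assumes "s > 0"
  shows "(s - 1) / s * (r\<^sup>2 - s / 2)\<^sup>2 =
    r ^ 4 - 2 * r ^ 3 + r\<^sup>2 + s\<^sup>2 / 4 - s / 4 - r\<^sup>2 * (s - r)\<^sup>2 / s"
  using assms by (simp add: field_simps power2_eq_square power3_eq_cube power4_eq_xxxx)

lemma objective_upper:
  fixes r s :: real
  assumes "0 < s" "s \<le> r\<^sup>2" "2 \<le> r"
  shows "(s - 1) / s * (r\<^sup>2 - s / 2)\<^sup>2 \<le> r ^ 4 - 2 * r ^ 3 + 5 / 4 * r\<^sup>2 + r"
proof -
  define w where "w = r\<^sup>2 * (s - r)\<^sup>2 / s"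
  have "s\<^sup>2 / 4 - s / 4 \<le> w + r\<^sup>2 / 4 + r"
  proof -
    consider "s \<le> r" | "r < s" "s \<le> 2 * r" | "2 * r < s" by linarith
    then show ?thesis
    proof cases
      case 1
      have "s\<^sup>2 \<le> r\<^sup>2" using 1 assms by (intro power_mono) auto
      moreover have "0 \<le> w" using assms by (simp add: w_def)
      ultimately show ?thesis using assms by linarith
    next
      case 2
      define u where "u = s - r"
      have "r * u\<^sup>2 / 2 = r\<^sup>2 * u\<^sup>2 / (2 * r)"
        using assms by (simp add: power2_eq_square)
      also have "\<dots> \<le> r\<^sup>2 * u\<^sup>2 / s"
        using 2 assms by (intro divide_left_mono) auto
      finally have w_ge: "r * u\<^sup>2 / 2 \<le> w" by (simp add: u_def w_def)
      have "2 * u\<^sup>2 \<le> r * u\<^sup>2" using assms by (intro mult_right_mono) auto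
      moreover have "0 \<le> r * (u - 1)\<^sup>2" using assms by simp
      then have "2 * r * u \<le> r * u\<^sup>2 + r"
        by (simp add: power2_eq_square algebra_simps)
      ultimately have "(u\<^sup>2 + 2 * r * u) / 4 \<le> r * u\<^sup>2 / 2 + r"
        using assms(3) zero_le_power2[of u] by argo
      moreover have "s\<^sup>2 = r\<^sup>2 + (u\<^sup>2 + 2 * r * u)"
        by (simp add: u_def power2_eq_square algebra_simps)
      ultimately show ?thesis using w_ge assms(1) by (simp add: field_simps)
    next
      case 3
      have "(s / 2)\<^sup>2 \<le> (s - r)\<^sup>2" using 3 assms by (intro power_mono) auto
      \<comment> \<open>Here the range limit \<open>s \<le> r^2\<close> enters, that is,
        \<open>q \<le> t - 1\<close>.\<close>
      then have "s * (s / 2)\<^sup>2 \<le> r\<^sup>2 * (s - r)\<^sup>2"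
        using assms by (intro mult_mono) auto
      then have "s\<^sup>2 / 4 \<le> w"
        using assms by (simp add: w_def field_simps power2_eq_square)
      then show ?thesis using assms zero_le_power2[of r] by linarith
    qed
  qed
  then show ?thesis unfolding objective_expand[OF assms(1)] w_def by linarith
qed

text \<open>Within distance 1 above \<open>r\<close> the penalty costs at most \<open>r\<close>, and
  replacing \<open>s^2 - s\<close> by \<open>r^2 - r\<close> leaves only \<open>- r / 4\<close>
  besides the main terms.\<close>

lemma objective_lower:
  fixes r s :: real
  assumes "1 \<le> r" "r \<le> s" "s \<le> r + 1"
  shows "r ^ 4 - 2 * r ^ 3 + 5 / 4 * r\<^sup>2 - 5 / 4 * r \<le> (s - 1) / s * (r\<^sup>2 - s / 2)\<^sup>2"
proof -
  have s: "0 < s" using assms by simp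
  have "0 \<le> (s - r) * (s + r - 1)" using assms by simp
  then have "r\<^sup>2 - r \<le> s\<^sup>2 - s" by (simp add: power2_eq_square algebra_simps)
  moreover have "r\<^sup>2 * (s - r)\<^sup>2 / s \<le> r\<^sup>2 * 1 / r"
    using assms by (intro frac_le mult_mono power_le_one) auto
  then have "r\<^sup>2 * (s - r)\<^sup>2 / s \<le> r"
    using assms by (simp add: power2_eq_square)
  ultimately show ?thesis unfolding objective_expand[OF s] by linarith
qed

lemma A_S_upper:
  assumes "4 \<le> t"
  shows "A_S t \<le> sqrt t ^ 4 - 2 * sqrt t ^ 3 + 5 / 4 * t + sqrt t"
proof (rule A_S_le)
  fix q assume "1 \<le> q" "q \<le> t - 1"
  then have "real q + 1 \<le> real t" by linarith
  moreover have "2 \<le> sqrt t" using assms by (simp add: real_le_rsqrt)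
  ultimately show "real q / (real q + 1) * (real t - (real q + 1) / 2)\<^sup>2 \<le>
      sqrt t ^ 4 - 2 * sqrt t ^ 3 + 5 / 4 * t + sqrt t"
    using objective_upper[of "real q + 1" "sqrt t"] by simp
qed (use assms in simp)

lemma A_S_lower:
  assumes "4 \<le> t"
  shows "sqrt t ^ 4 - 2 * sqrt t ^ 3 + 5 / 4 * t - 5 / 4 * sqrt t \<le> A_S t"
proof -
  \<comment> \<open>With this choice \<open>s = q + 1\<close> is the ceiling of
    \<open>sqrt t\<close>, so it lies between \<open>r\<close> and \<open>r + 1\<close>.\<close>
  define q where "q = nat \<lceil>sqrt t\<rceil> - 1"
  have r: "2 \<le> sqrt t" using assms by (simp add: real_le_rsqrt)
  then have q: "real q = real_of_int \<lceil>sqrt t\<rceil> - 1" unfolding q_def by linarith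
  have "2 * sqrt t \<le> sqrt t * sqrt t" using r by (intro mult_right_mono) auto
  then have "sqrt t + 1 \<le> real t" using r by simp
  then have "1 \<le> q" "q \<le> t - 1" using r q by linarith+
  note A_S_ge[OF this]
  moreover have "sqrt t ^ 4 - 2 * sqrt t ^ 3 + 5 / 4 * t - 5 / 4 * sqrt t
      \<le> real q / (real q + 1) * (real t - (real q + 1) / 2)\<^sup>2"
    using objective_lower[of "sqrt t" "real q + 1"] r q assms by simp
  ultimately show ?thesis by linarith
qed

section \<open>Asymptotic expansion of \<open>c_S\<close>\<close>

lemma real_d: "real (d t) = real t * (real t - 1) / 2"
  by (cases t) (auto simp: d_def choose_two real_of_nat_div algebra_simps)

text \<open>Truncation at 0 cannot increase the distance to a nonnegative \<open>y\<close>, and a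
  value between \<open>l\<close> and \<open>u\<close> is no farther from \<open>y\<close> than the
  worse endpoint.\<close>

lemma abs_max_diff_le:
  fixes x y l u :: real
  assumes "0 \<le> y" "l \<le> x" "x \<le> u"
  shows "\<bar>max 0 x - y\<bar> \<le> \<bar>l - y\<bar> + \<bar>u - y\<bar>"
  using assms by linarith

lemma c_S_asymptotic:
  "(\<lambda>t::nat. c_S t - (1 / 2 - 1 / sqrt (real t) - 7 / (8 * real t)))
     \<in> O(\<lambda>t. real t powr (- 3 / 2))"
proof -
  define m where "m t = 1 / 2 - 1 / sqrt (real t) - 7 / (8 * real t)" for t
  define L where "L t = sqrt t ^ 4 - 2 * sqrt t ^ 3 + 5 / 4 * t - 5 / 4 * sqrt t" for t :: nat
  define U where "U t = sqrt t ^ 4 - 2 * sqrt t ^ 3 + 5 / 4 * t + sqrt t" for t :: nat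
  define l where "l t = 1 - real t * (real t - 1) / 2 / L t" for t
  define u where "u t = 1 - real t * (real t - 1) / 2 / U t" for t
  \<comment> \<open>\<open>L\<close> and \<open>U\<close> differ by a multiple of
    \<open>sqrt t\<close>, which relative to \<open>t^2\<close> is of order
    \<open>t powr (- 3 / 2)\<close>; hence both ends share the expansion \<open>m\<close>.\<close>
  have "(\<lambda>t. l t - m t) \<in> O(\<lambda>t. real t powr (- 3 / 2))"
    unfolding l_def m_def L_def by real_asymp
  moreover have "(\<lambda>t. u t - m t) \<in> O(\<lambda>t. real t powr (- 3 / 2))"
    unfolding u_def m_def U_def by real_asymp
  ultimately have "(\<lambda>t. \<bar>l t - m t\<bar> + \<bar>u t - m t\<bar>) \<in> O(\<lambda>t. real t powr (- 3 / 2))"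
    by (intro sum_in_bigo) auto
  moreover have "eventually (\<lambda>t. norm (c_S t - m t) \<le> norm (\<bar>l t - m t\<bar> + \<bar>u t - m t\<bar>)) at_top"
  proof -
    have "eventually (\<lambda>t. 0 < L t) at_top" "eventually (\<lambda>t. 0 < m t) at_top"
      unfolding L_def m_def by real_asymp+
    then show ?thesis
      using eventually_ge_at_top[of 4]
    proof eventually_elim
      case (elim t)
      have A: "L t \<le> A_S t" "A_S t \<le> U t"
        using A_S_lower A_S_upper elim by (auto simp: L_def U_def)
      have "l t \<le> 1 - real (d t) / A_S t" "1 - real (d t) / A_S t \<le> u t"
        using A elim by (auto simp: l_def u_def real_d intro!: divide_left_mono)
      then show ?case
        using abs_max_diff_le[of "m t" "l t" "1 - real (d t) / A_S t" "u t"] elim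
        by (simp add: c_S_def)
    qed
  qed
  ultimately have "(\<lambda>t. c_S t - m t) \<in> O(\<lambda>t. real t powr (- 3 / 2))"
    by (rule landau_o.big_mono[THEN landau_o.big_trans, rotated])
  then show ?thesis by (simp only: m_def)
qed

section \<open>The root \<open>x0\<close> and a numerical bound for \<open>gamma0\<close>\<close>

lemma cos_taylor_lower:
  fixes x :: real
  shows "1 - x\<^sup>2 / 2 + x ^ 4 / 24 - x ^ 6 / 720 \<le> cos x"
proof -
  obtain t where t: "cos x = (\<Sum>m<6. cos_coeff m * x ^ m) + cos (t + 1/2 * real 6 * pi) / fact 6 * x ^ 6"
    using Maclaurin_cos_expansion[of x 6] by auto
  have "{..<6} = {0, 1, 2, 3, 4, 5 :: nat}" by auto
  then have "(\<Sum>m<6. cos_coeff m * x ^ m) = 1 - x\<^sup>2 / 2 + x ^ 4 / 24"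
    by (simp add: cos_coeff_def fact_numeral)
  moreover have "(-1) * x ^ 6 \<le> cos (t + 1/2 * real 6 * pi) * x ^ 6"
    by (intro mult_right_mono) auto
  ultimately show ?thesis
    unfolding t by (simp add: fact_numeral)
qed

lemma pi_gt: "313 / 100 < pi"
proof (rule ccontr)
  assume "\<not> 313 / 100 < pi"
  then have "cos (313 / 200) \<le> cos (pi / 2)"
    using pi_ge_two by (intro cos_monotone_0_pi_le) auto
  \<comment> \<open>At 313 / 200 the Taylor polynomial is still positive, about 0.005.\<close>
  then show False using cos_taylor_lower[of "313 / 200"] by (simp add: power_divide)
qed

lemma tan_fixpoint_iff:
  fixes x :: real
  assumes "x \<noteq> 0"
  shows "tan x = x \<longleftrightarrow> sin x - x * cos x = 0"
proof (cases "cos x = 0")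
  \<comment> \<open>Here \<open>tan x\<close> is 0 by the division convention, so both sides are
    false.\<close>
  case True
  then have "sin x \<noteq> 0" using sin_cos_squared_add[of x] by auto
  with True assms show ?thesis by (simp add: tan_def)
qed (simp add: tan_def field_simps)

text \<open>Since \<open>g\<close> has derivative \<open>x * sin x\<close> and
  \<open>g 0 = 0\<close>, it rises up to \<open>pi\<close> and then falls to -1 at
  \<open>3 * pi / 2\<close>. Its only zero in between is therefore the first positive root.\<close>

lemma x0_props: "x0 \<in> {pi<..<3 * pi / 2}" "tan x0 = x0"
proof -
  define g :: "real \<Rightarrow> real" where "g x = sin x - x * cos x" for x
  have deriv: "(g has_real_derivative x * sin x) (at x)" for x
    unfolding g_def by (auto intro!: derivative_eq_intros)
  have cont: "continuous_on S g" for S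
    unfolding g_def by (intro continuous_intros)
  have g_mid: "0 < g y" if "0 < y" "y \<le> pi" for y
  proof -
    have "g 0 < g y"
    proof (rule DERIV_pos_imp_increasing_open[OF \<open>0 < y\<close>])
      fix z assume "0 < z" "z < y"
      then have "0 < z * sin z" using that by (intro mult_pos_pos sin_gt_zero) auto
      then show "\<exists>D. (g has_real_derivative D) (at z) \<and> 0 < D" using deriv by blast
    qed (rule cont)
    then show ?thesis by (simp add: g_def)
  qed
  have g_dec: "g x < g y" if "pi \<le> y" "y < x" "x \<le> 3 * pi / 2" for x y
  proof (rule DERIV_neg_imp_decreasing_open[OF \<open>y < x\<close>])
    fix z assume z: "y < z" "z < x"
    have "0 < sin (z - pi)" using z that by (intro sin_gt_zero) auto
    then have "z * sin z < 0" using z that pi_gt_zero by (intro mult_pos_neg) auto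
    then show "\<exists>D. (g has_real_derivative D) (at z) \<and> D < 0" using deriv by blast
  qed (rule cont)
  have end_val: "g (3 * pi / 2) = -1"
    using sin_3over2_pi cos_3over2_pi by (simp add: g_def)
  have "\<exists>x\<ge>pi. x \<le> 3 * pi / 2 \<and> g x = 0"
    using g_mid[of pi] end_val cont by (intro IVT2') auto
  then obtain x where x: "pi \<le> x" "x \<le> 3 * pi / 2" "g x = 0" by blast
  have "x \<noteq> pi" "x \<noteq> 3 * pi / 2" using x(3) g_mid[of pi] end_val pi_gt_zero by force+
  then have range: "x \<in> {pi<..<3 * pi / 2}" using x by auto
  have root: "tan y = y \<longleftrightarrow> g y = 0" if "0 < y" for y
    using tan_fixpoint_iff[of y] that by (simp add: g_def)
  have "tan y \<noteq> y" if "y \<in> {0<..<x}" for y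
    using that root[of y] g_mid[of y] g_dec[of y x] x by (cases "y \<le> pi") auto
  moreover have "tan x = x" using root[of x] range pi_gt_zero x by auto
  ultimately have first: "x \<in> {pi<..<3 * pi / 2} \<and> tan x = x \<and> (\<forall>y\<in>{0<..<x}. tan y \<noteq> y)"
    using range by blast
  \<comment> \<open>Of two distinct candidates, the smaller would violate the minimality of the
    larger.\<close>
  moreover have "z = x"
    if "z \<in> {pi<..<3 * pi / 2} \<and> tan z = z \<and> (\<forall>y\<in>{0<..<z}. tan y \<noteq> y)" for z
    using that first pi_gt_zero by (cases z x rule: linorder_cases) auto
  ultimately have "x0 = x" unfolding x0_def by (rule the_equality)
  with first show "x0 \<in> {pi<..<3 * pi / 2}" "tan x0 = x0" by auto
qed

text \<open>
  If \<open>gamma0 \<ge> 4 / 9\<close>, then \<open>x0 = tan (x0 - pi)\<close> is below \<open>4.39\<close>, so \<open>x0 - pi < 1.26\<close>, and this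
  improves the bound on the tangent to \<open>x0 < 3.13 < pi\<close>.
\<close>
lemma gamma0_less: "gamma0 < 4 / 9"
proof -
  define y where "y = x0 - pi"
  have x0: "pi < x0" "x0 < 3 * pi / 2" using x0_props by auto
  have y: "0 < y" "y < pi / 2" using x0 by (auto simp: y_def)
  have cos_x0: "cos x0 = - cos y" by (simp add: y_def)
  have sin_x0: "sin x0 = x0 * cos x0"
    using tan_fixpoint_iff[of x0] x0 pi_gt_zero x0_props(2) by auto
  have gamma: "gamma0 = 2 * cos y"
    using x0 pi_gt_zero by (simp add: gamma0_def sin_x0 cos_x0)
  \<comment> \<open>Pythagoras with \<open>sin x0 = x0 * cos x0\<close> turns lower bounds on
    \<open>cos y\<close> into upper bounds on \<open>x0\<close>.\<close>
  have sq: "(x0\<^sup>2 + 1) * (cos y)\<^sup>2 = 1"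
    using sin_cos_squared_add[of x0] by (simp add: sin_x0 cos_x0 power_mult_distrib algebra_simps)
  have x0_bound: "(x0\<^sup>2 + 1) * c\<^sup>2 \<le> 1" if "0 \<le> c" "c \<le> cos y" for c
  proof -
    have "(x0\<^sup>2 + 1) * c\<^sup>2 \<le> (x0\<^sup>2 + 1) * (cos y)\<^sup>2"
      using that by (intro mult_left_mono power_mono) auto
    then show ?thesis by (simp only: sq)
  qed
  show ?thesis
  proof (rule ccontr)
    assume "\<not> gamma0 < 4 / 9"
    then have "2 / 9 \<le> cos y" using gamma by simp
    then have "x0\<^sup>2 < (439 / 100)\<^sup>2"
      using x0_bound[of "2 / 9"] by (simp add: power_divide)
    then have "x0 < 439 / 100" by (rule power_less_imp_less_base) simp
    then have "y \<le> 63 / 50" using pi_gt by (simp add: y_def)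
    then have "cos (63 / 50) \<le> cos y"
      using y pi_gt by (intro cos_monotone_0_pi_le) auto
    then have "61 / 200 \<le> cos y"
      using cos_taylor_lower[of "63 / 50"] by (simp add: power_divide)
    then have "x0\<^sup>2 < (313 / 100)\<^sup>2"
      using x0_bound[of "61 / 200"] by (simp add: power_divide)
    then have "x0 < 313 / 100" by (rule power_less_imp_less_base) simp
    then show False using x0 pi_gt by simp
  qed
qed

section \<open>Comparison of \<open>c_S\<close> with \<open>c_F\<close>\<close>

lemma c_S_greater_c_F:
  assumes "14 \<le> t"
  shows "c_F t < c_S t"
proof -
  define x where "x = real t"
  have x: "14 \<le> x" using assms by (simp add: x_def)
  have "(x - 1) * gamma0 < (x - 1) * (4 / 9)"
    using gamma0_less x by (intro mult_strict_left_mono) auto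
  then have "c_F t < ((x - 1) * (4 / 9) - 2) / (2 * (x - 2))"
    unfolding c_F_def x_def[symmetric] using x by (intro divide_strict_right_mono) auto
  also have "\<dots> \<le> 1 - x * (x - 1) / 2 / (3 / 4 * (x - 2)\<^sup>2)"
  proof -
    \<comment> \<open>Cross-multiplying reduces the claim to this cubic. Equality holds at
      \<open>x = 14\<close>, so there the strictness comes from
      \<open>gamma0 < 4 / 9\<close>.\<close>
    have "0 \<le> (x - 1) * (x - 2) * (x - 14)" using x by simp
    then have "17 * (x * x) + 28 \<le> x * (x * x) + 44 * x"
      unfolding left_diff_distrib right_diff_distrib by simp
    then show ?thesis using x by (simp add: divide_simps power2_eq_square) (simp add: algebra_simps)
  qed
  also have "\<dots> \<le> 1 - x * (x - 1) / 2 / A_S t"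
  proof -
    have "3 / 4 * (x - 2)\<^sup>2 \<le> A_S t"
      using A_S_ge[of 3 t] assms by (simp add: x_def)
    moreover have "0 < 3 / 4 * (x - 2)\<^sup>2" using x by simp
    moreover from calculation have "0 < A_S t" by linarith
    ultimately show ?thesis
      using x by (intro diff_left_mono divide_left_mono mult_pos_pos) auto
  qed
  also have "\<dots> \<le> c_S t"
    by (simp add: c_S_def real_d x_def)
  finally show ?thesis .
qed

theorem corollary4p2:
  shows "(\<lambda>t::nat. c_S t - (1 / 2 - 1 / sqrt (real t) - 7 / (8 * real t)))
           \<in> O(\<lambda>t. real t powr (- 3 / 2))
         \<and> (\<forall>t::nat. t \<ge> 14 \<longrightarrow> c_S t > c_F t)"
  using c_S_asymptotic c_S_greater_c_F by blast

end
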